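(* Let $X$ be a real reflexive Banach space and let $C$ and $D$ be disjoint nonempty closed convex subsets of $X$ such that $\operatorname{rec}(C)\cap\operatorname{rec}(D)=\{0\}$. If, in addition, $(\operatorname{int}\operatorname{bar}(C))\cup(\operatorname{int}\operatorname{bar}(D))\neq\emptyset$, then $C$ and $D$ are strongly separated.
   Context: For a closed convex set $C\subset X$: the recession cone is $\operatorname{rec}(C)=\{v\in X: c+v\in C\ \ \forall c\in C\}$; the barrier cone is $\operatorname{bar}(C)=\{x^*\in X^*: \sup_{c\in C}\langle x^*,c\rangle<+\infty\}$; $\operatorname{int}$ denotes interior in the norm topology of $X^*$. Convex sets $C,D\subset X$ are strongly separated if there exists $x^*\in X^*\setminus\{0\}$ with $\sup_{c\in C}\langle x^*,c\rangle<\inf_{d\in D}\langle x^*,d\rangle$. *)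

theory Defs
  imports "HOL-Analysis.Analysis"
begin

text \<open>The dual space $X^*$ is the type of bounded linear functionals
  \<^typ>\<open>'a::real_normed_vector \<Rightarrow>\<^sub>L real\<close> with the operator norm, so that
  \<^const>\<open>interior\<close> on it refers to the norm topology.\<close>

type_synonym 'a dual = "'a \<Rightarrow>\<^sub>L real"

definition canonical_embedding :: "'a::real_normed_vector \<Rightarrow> 'a dual dual"
  where "canonical_embedding x = Blinfun (\<lambda>f. blinfun_apply f x)"

lemma canonical_embedding_apply [simp]:
  "blinfun_apply (canonical_embedding x) f = blinfun_apply f x"
  unfolding canonical_embedding_def
  by (simp add: bounded_linear_Blinfun_apply blinfun.bounded_linear_left)

definition reflexive_space :: "'a::real_normed_vector itself \<Rightarrow> bool"
  where "reflexive_space (_ :: 'a itself) \<longleftrightarrow> surj (canonical_embedding :: 'a \<Rightarrow> 'a dual dual)"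

definition recession_cone :: "'a::real_normed_vector set \<Rightarrow> 'a set"
  where "recession_cone C = {v. \<forall>c\<in>C. c + v \<in> C}"

text \<open>Suprema and infima of functionals are taken in the extended reals, since on
  \<^typ>\<open>real\<close> they carry no information for unbounded sets.\<close>

definition barrier_cone :: "'a::real_normed_vector set \<Rightarrow> 'a dual set"
  where "barrier_cone C = {f. (SUP c\<in>C. ereal (blinfun_apply f c)) < \<infinity>}"

definition strongly_separated :: "'a::real_normed_vector set \<Rightarrow> 'a set \<Rightarrow> bool"
  where "strongly_separated C D \<longleftrightarrow>
    (\<exists>f :: 'a dual. f \<noteq> 0 \<and>
      (SUP c\<in>C. ereal (blinfun_apply f c)) < (INF d\<in>D. ereal (blinfun_apply f d)))"

end

theory Submission
  imports Defs
begin

text \<open>If \<open>C\<close> and \<open>D\<close> have positive distance, a functional bounded away from zero on \<open>D - C\<close>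
  separates them strongly. Otherwise take \<open>c n \<in> C\<close>, \<open>d n \<in> D\<close> with \<open>c n - d n\<close> tending to \<open>0\<close>.
  If the \<open>c n\<close> can be chosen bounded, a weak cluster point lies in \<open>C \<inter> D\<close>. If not, a weak cluster
  point \<open>v\<close> of \<open>c n / norm (c n)\<close> lies in both recession cones, so \<open>v = 0\<close>; but an interior point
  of the barrier cone of \<open>C\<close> yields \<open>f\<close> and \<open>s > 0\<close> with \<open>f c + s * norm c\<close> bounded above on \<open>C\<close>,
  which forces \<open>f v < 0\<close>.\<close>

section \<open>Sublinear functions and the Hahn-Banach theorem\<close>

text \<open>Homogeneity is an inequality because infimum constructions deliver it in that form;
  applied to the factor \<open>inverse t\<close> it becomes an equality.\<close>

definition sublinear :: "('v::real_vector \<Rightarrow> real) \<Rightarrow> bool"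
  where "sublinear p \<longleftrightarrow>
    (\<forall>x y. p (x + y) \<le> p x + p y) \<and> (\<forall>t>0. \<forall>x. p (t *\<^sub>R x) \<le> t * p x)"

lemma sublinear_add: "sublinear p \<Longrightarrow> p (x + y) \<le> p x + p y"
  by (simp add: sublinear_def)

lemma sublinear_scale:
  assumes "sublinear p" "t > 0"
  shows "p (t *\<^sub>R x) = t * p x"
proof (rule antisym)
  show "p (t *\<^sub>R x) \<le> t * p x"
    using assms by (simp add: sublinear_def)
  have "p (inverse t *\<^sub>R (t *\<^sub>R x)) \<le> inverse t * p (t *\<^sub>R x)"
    using assms unfolding sublinear_def by (meson positive_imp_inverse_positive)
  then show "t * p x \<le> p (t *\<^sub>R x)"
    using assms by (simp add: field_simps)
qed

lemma sublinear_zero: "sublinear p \<Longrightarrow> p 0 = 0"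
  using sublinear_scale[of p 2 0] by simp

lemma sublinear_scale_nonneg: "sublinear p \<Longrightarrow> t \<ge> 0 \<Longrightarrow> p (t *\<^sub>R x) = t * p x"
  by (cases "t = 0") (simp_all add: sublinear_scale sublinear_zero)

lemma sublinear_ge_minus: "sublinear p \<Longrightarrow> - p (- x) \<le> p x"
  using sublinear_add[of p x "- x"] sublinear_zero[of p] by simp

text \<open>The pattern for all sublinear functions built below: candidates for \<open>x\<close> and
  \<open>y\<close> combine into one for \<open>x + y\<close> and scale along with \<open>x\<close>,
  and both properties pass to the infimum.\<close>

lemma sublinear_Inf:
  assumes ne: "\<And>x. S x \<noteq> {}"
    and bdd: "\<And>x. bdd_below (S x)"
    and add: "\<And>x y a b. a \<in> S x \<Longrightarrow> b \<in> S y \<Longrightarrow> \<exists>c\<in>S (x + y). c \<le> a + b"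
    and scale: "\<And>x a t. a \<in> S x \<Longrightarrow> t > 0 \<Longrightarrow> \<exists>c\<in>S (t *\<^sub>R x). c \<le> t * a"
  shows "sublinear (\<lambda>x. Inf (S x) :: real)"
proof -
  have "Inf (S (x + y)) \<le> Inf (S x) + Inf (S y)" for x y
  proof -
    have *: "Inf (S (x + y)) - b \<le> a" if ab: "a \<in> S x" "b \<in> S y" for a b
    proof -
      obtain c where "c \<in> S (x + y)" "c \<le> a + b"
        using add[OF ab] by blast
      then show ?thesis
        using cInf_lower[OF _ bdd] by fastforce
    qed
    have "Inf (S (x + y)) - Inf (S x) \<le> b" if "b \<in> S y" for b
      using cInf_greatest[OF ne, of x "Inf (S (x + y)) - b"] *[OF _ that] by fastforce
    then show ?thesis
      using cInf_greatest[OF ne, of y "Inf (S (x + y)) - Inf (S x)"] by fastforce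
  qed
  moreover have "Inf (S (t *\<^sub>R x)) \<le> t * Inf (S x)" if t: "t > 0" for t x
  proof -
    have "Inf (S (t *\<^sub>R x)) / t \<le> a" if a: "a \<in> S x" for a
    proof -
      obtain c where "c \<in> S (t *\<^sub>R x)" "c \<le> t * a"
        using scale[OF a t] by blast
      then have "Inf (S (t *\<^sub>R x)) \<le> t * a"
        using cInf_lower[OF _ bdd] by fastforce
      then show ?thesis
        using t by (simp add: field_simps)
    qed
    then have "Inf (S (t *\<^sub>R x)) / t \<le> Inf (S x)"
      using cInf_greatest[OF ne] by blast
    then show ?thesis
      using t by (simp add: field_simps)
  qed
  ultimately show ?thesis
    by (simp add: sublinear_def)
qed

text \<open>By this construction a minimal sublinear function is odd, hence linear. The function is
  \<open>r x = inf {q (x + t y) - t q y | t \<ge> 0}\<close>.\<close>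

lemma sublinear_tilt:
  fixes q :: "'v::real_vector \<Rightarrow> real"
  assumes q: "sublinear q"
  obtains r where "sublinear r" "\<And>x. r x \<le> q x" "r (- y) \<le> - q y"
proof
  define S where "S x = {q (x + t *\<^sub>R y) - t * q y |t. t \<ge> 0}" for x
  have bdd: "bdd_below (S x)" for x
  proof (rule bdd_belowI)
    fix a assume "a \<in> S x"
    then obtain t where t: "t \<ge> 0" "a = q (x + t *\<^sub>R y) - t * q y"
      unfolding S_def by blast
    have "q (t *\<^sub>R y) \<le> q (x + t *\<^sub>R y) + q (- x)"
      using sublinear_add[OF q, of "x + t *\<^sub>R y" "- x"] by simp
    then show "- q (- x) \<le> a"
      using t sublinear_scale_nonneg[OF q t(1), of y] by simp
  qed
  show "sublinear (\<lambda>x. Inf (S x))"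
  proof (rule sublinear_Inf[OF _ bdd])
    show "S x \<noteq> {}" for x
      unfolding S_def by (blast intro: order_refl)
    show "\<exists>c\<in>S (x + z). c \<le> a + b" if ab: "a \<in> S x" "b \<in> S z" for x z a b
    proof -
      obtain s t where st: "s \<ge> 0" "t \<ge> 0" "a = q (x + s *\<^sub>R y) - s * q y"
        "b = q (z + t *\<^sub>R y) - t * q y"
        using ab unfolding S_def by blast
      have "q ((x + z) + (s + t) *\<^sub>R y) \<le> q (x + s *\<^sub>R y) + q (z + t *\<^sub>R y)"
        using sublinear_add[OF q, of "x + s *\<^sub>R y" "z + t *\<^sub>R y"] by (simp add: algebra_simps)
      then have "q ((x + z) + (s + t) *\<^sub>R y) - (s + t) * q y \<le> a + b"
        using st by (simp add: algebra_simps)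
      moreover have "q ((x + z) + (s + t) *\<^sub>R y) - (s + t) * q y \<in> S (x + z)"
        unfolding S_def using st add_nonneg_nonneg by blast
      ultimately show ?thesis by blast
    qed
    show "\<exists>c\<in>S (u *\<^sub>R x). c \<le> u * a" if a: "a \<in> S x" and u: "u > 0" for x a u
    proof -
      obtain s where s: "s \<ge> 0" "a = q (x + s *\<^sub>R y) - s * q y"
        using a unfolding S_def by blast
      have "u * a = q (u *\<^sub>R x + (u * s) *\<^sub>R y) - (u * s) * q y"
        using sublinear_scale[OF q u, of "x + s *\<^sub>R y"]
        by (simp add: s(2) scaleR_add_right right_diff_distrib)
      moreover have "u * s \<ge> 0" using s u by simp
      ultimately have "u * a \<in> S (u *\<^sub>R x)"
        unfolding S_def by blast
      then show ?thesis by blast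
    qed
  qed
  show "Inf (S x) \<le> q x" for x
  proof (rule cInf_lower[OF _ bdd])
    show "q x \<in> S x"
      unfolding S_def by (rule CollectI, rule exI[of _ 0]) simp
  qed
  \<comment> \<open>At \<open>t = 1\<close> the argument \<open>- y + y\<close> vanishes and only
    \<open>- q y\<close> is left.\<close>
  show "Inf (S (- y)) \<le> - q y"
  proof (rule cInf_lower[OF _ bdd])
    show "- q y \<in> S (- y)"
      unfolding S_def by (rule CollectI, rule exI[of _ 1]) (simp add: sublinear_zero[OF q])
  qed
qed

text \<open>Zorn's lemma for the reversed order: a nonempty chain below \<open>p\<close> has its
  pointwise infimum as lower bound, finite since \<open>- p (- x) \<le> - q (- x) \<le> q x\<close>
  for every sublinear \<open>q \<le> p\<close>.\<close>

lemma minimal_sublinear_exists: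
  fixes p :: "'v::real_vector \<Rightarrow> real"
  assumes p: "sublinear p"
  obtains m where "sublinear m" "m \<le> p" "\<And>q. sublinear q \<Longrightarrow> q \<le> m \<Longrightarrow> q = m"
proof -
  define A where "A = {q. sublinear q \<and> q \<le> p}"
  have "\<exists>m\<in>A. \<forall>a\<in>A. m \<ge> a \<longrightarrow> a = m"
  proof (rule predicate_Zorn)
    show "partial_order_on A (relation_of (\<ge>) A)"
      by (rule partial_order_on_relation_ofI) auto
  next
    fix Q assume Q: "Q \<in> Chains (relation_of (\<ge>) A)"
    then have QA: "Q \<subseteq> A"
      by (auto simp: Chains_def relation_of_def)
    have chain: "f \<le> g \<or> g \<le> f" if "f \<in> Q" "g \<in> Q" for f g
      using Q that by (auto simp: Chains_def relation_of_def)
    show "\<exists>u\<in>A. \<forall>a\<in>Q. a \<ge> u"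
    proof (cases "Q = {}")
      case True
      then show ?thesis using p by (auto simp: A_def)
    next
      case False
      define S where "S x = (\<lambda>q. q x) ` Q" for x
      have bdd: "bdd_below (S x)" for x
      proof (rule bdd_belowI)
        fix a assume "a \<in> S x"
        then obtain q where "a = q x" "sublinear q" "q \<le> p"
          using QA by (auto simp: S_def A_def)
        then show "- p (- x) \<le> a"
          using sublinear_ge_minus[of q x] le_funD[of q p "- x"] by linarith
      qed
      have sub: "sublinear (\<lambda>x. Inf (S x))"
      proof (rule sublinear_Inf[OF _ bdd])
        show "S x \<noteq> {}" for x
          using False by (simp add: S_def)
        show "\<exists>c\<in>S (x + y). c \<le> a + b" if ab: "a \<in> S x" "b \<in> S y" for x y a b
        proof -
          obtain f g where fg: "f \<in> Q" "g \<in> Q" "a = f x" "b = g y"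
            using ab by (auto simp: S_def)
          \<comment> \<open>In a chain the smaller of \<open>f\<close> and \<open>g\<close> is a
            member below both, so its subadditivity compares with \<open>f x + g y\<close>.\<close>
          obtain h where h: "h \<in> Q" "h \<le> f" "h \<le> g"
            using chain[OF fg(1,2)] fg by blast
          have "h (x + y) \<le> h x + h y"
            using h QA by (auto simp: A_def sublinear_def)
          also have "\<dots> \<le> a + b"
            using fg h by (simp add: add_mono le_funD)
          finally show ?thesis
            using h by (auto simp: S_def)
        qed
        show "\<exists>c\<in>S (t *\<^sub>R x). c \<le> t * a" if "a \<in> S x" "t > 0" for x a t
          using that QA by (auto simp: S_def A_def sublinear_def)
      qed
      have lower: "(\<lambda>x. Inf (S x)) \<le> q" if "q \<in> Q" for q
        using that by (auto simp: le_fun_def S_def intro!: cInf_lower bdd[unfolded S_def])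
      obtain q where "q \<in> Q" using False by blast
      then have "(\<lambda>x. Inf (S x)) \<le> p"
        using lower[of q] QA unfolding A_def by fastforce
      then show ?thesis
        using sub lower unfolding A_def by blast
    qed
  qed
  then obtain m where "sublinear m" "m \<le> p" "\<And>q. sublinear q \<Longrightarrow> q \<le> p \<Longrightarrow> q \<le> m \<Longrightarrow> q = m"
    unfolding A_def by blast
  then show thesis
    using that[of m] by (meson order_trans)
qed

text \<open>A minimal \<open>m\<close> equals each of its tilts, so it is odd; subadditivity at
  \<open>x\<close>, \<open>y\<close> and at \<open>- x\<close>, \<open>- y\<close> then gives
  additivity.\<close>

theorem Hahn_Banach_sublinear:
  fixes p :: "'v::real_vector \<Rightarrow> real"
  assumes p: "sublinear p"
  obtains f where "linear f" "\<And>x. f x \<le> p x"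
proof -
  obtain m where m: "sublinear m" "m \<le> p" and min: "\<And>q. sublinear q \<Longrightarrow> q \<le> m \<Longrightarrow> q = m"
    using minimal_sublinear_exists[OF p] by blast
  have neg: "m (- y) = - m y" for y
  proof -
    obtain r where r: "sublinear r" "\<And>x. r x \<le> m x" "r (- y) \<le> - m y"
      using sublinear_tilt[OF m(1), of y] by blast
    then have "r = m"
      using min by (simp add: le_fun_def)
    then show ?thesis
      using r(3) sublinear_ge_minus[OF m(1), of y] by simp
  qed
  have "linear m"
  proof (rule linearI)
    show "m (x + y) = m x + m y" for x y
      using sublinear_add[OF m(1), of x y] sublinear_add[OF m(1), of "- x" "- y"]
        neg[of x] neg[of y] neg[of "x + y"] by simp
    show "m (t *\<^sub>R x) = t *\<^sub>R m x" for t x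
    proof (cases "t \<ge> 0")
      case True
      then show ?thesis by (simp add: sublinear_scale_nonneg[OF m(1)])
    next
      case False
      then have "m ((- t) *\<^sub>R x) = (- t) * m x"
        by (intro sublinear_scale_nonneg[OF m(1)]) simp
      then show ?thesis using neg[of "t *\<^sub>R x"] by simp
    qed
  qed
  then show thesis
    using m(2) that by (auto simp: le_fun_def)
qed

section \<open>Bounded functionals and separation of convex sets\<close>

lemma Hahn_Banach_dual:
  fixes p :: "'v::real_normed_vector \<Rightarrow> real"
  assumes p: "sublinear p" and bound: "\<And>x. p x \<le> B * norm x"
  obtains f :: "'v dual" where "\<And>x. blinfun_apply f x \<le> p x"
proof -
  obtain g where g: "linear g" "\<And>x. g x \<le> p x"
    using Hahn_Banach_sublinear[OF p] by blast
  have "\<bar>g x\<bar> \<le> B * norm x" for x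
    using g(2)[of x] g(2)[of "- x"] bound[of x] bound[of "- x"] linear_neg[OF g(1), of x] by simp
  then have "bounded_linear g"
    using g(1) by (intro bounded_linear.intro) 
      (auto simp: bounded_linear_axioms_def mult.commute)
  then show thesis
    using that[of "Blinfun g"] g(2) by (simp add: bounded_linear_Blinfun_apply)
qed

text \<open>The functional is found below the largest sublinear function that is at most the norm
  everywhere and at most \<open>- r\<close> on \<open>- K\<close>.\<close>

lemma convex_away_from_zero_functional:
  fixes K :: "'v::real_normed_vector set"
  assumes K: "convex K" "K \<noteq> {}" and far: "\<And>k. k \<in> K \<Longrightarrow> r \<le> norm k"
  obtains f :: "'v dual" where "norm f \<le> 1" "\<And>k. k \<in> K \<Longrightarrow> r \<le> blinfun_apply f k"
proof -
  \<comment> \<open>Each \<open>x\<close> splits as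
    \<open>(x + t *\<^sub>R k) + t *\<^sub>R (- k)\<close>; the first part costs its norm, the
    second \<open>- t * r\<close>.\<close>
  define S where "S x = {norm (x + t *\<^sub>R k) - t * r |t k. t \<ge> 0 \<and> k \<in> K}" for x
  obtain k0 where k0: "k0 \<in> K" using K by blast
  have bdd: "bdd_below (S x)" for x
  proof (rule bdd_belowI)
    fix a assume "a \<in> S x"
    then obtain t k where t: "t \<ge> 0" "k \<in> K" "a = norm (x + t *\<^sub>R k) - t * r"
      unfolding S_def by blast
    have "t * r \<le> t * norm k"
      using t far by (simp add: mult_left_mono)
    also have "\<dots> \<le> norm (x + t *\<^sub>R k) + norm x"
      using norm_triangle_ineq4[of "x + t *\<^sub>R k" x] t by simp
    finally show "- norm x \<le> a" using t by simp
  qed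
  have sub: "sublinear (\<lambda>x. Inf (S x))"
  proof (rule sublinear_Inf[OF _ bdd])
    show "S x \<noteq> {}" for x
      unfolding S_def using k0 by (blast intro: order_refl)
    show "\<exists>c\<in>S (x + y). c \<le> a + b" if ab: "a \<in> S x" "b \<in> S y" for x y a b
    proof -
      obtain s k t l where st: "s \<ge> 0" "k \<in> K" "a = norm (x + s *\<^sub>R k) - s * r"
        "t \<ge> 0" "l \<in> K" "b = norm (y + t *\<^sub>R l) - t * r"
        using ab unfolding S_def by blast
      \<comment> \<open>\<open>j\<close> is the convex combination of \<open>k\<close> and
        \<open>l\<close> with weights \<open>s / (s + t)\<close> and \<open>t / (s + t)\<close>; if
        both parameters vanish any point of \<open>K\<close> will do, here
        \<open>k0\<close>.\<close>
      obtain j where j: "j \<in> K" "s *\<^sub>R k + t *\<^sub>R l = (s + t) *\<^sub>R j"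
      proof (cases "s + t = 0")
        case True
        then have "s = 0" "t = 0" using st by auto
        then show thesis using that[OF k0] by simp
      next
        case False
        have "(s / (s + t)) *\<^sub>R k + (t / (s + t)) *\<^sub>R l \<in> K"
          using st False by (intro convexD[OF K(1)]) (auto simp: add_divide_distrib[symmetric])
        then show thesis
          by (rule that) (use False in \<open>simp add: scaleR_add_right\<close>)
      qed
      have "norm ((x + y) + (s + t) *\<^sub>R j) \<le> norm (x + s *\<^sub>R k) + norm (y + t *\<^sub>R l)"
        using norm_triangle_ineq[of "x + s *\<^sub>R k" "y + t *\<^sub>R l"]
        unfolding j(2)[symmetric] by (simp add: add_ac)
      then have "norm ((x + y) + (s + t) *\<^sub>R j) - (s + t) * r \<le> a + b"
        using st by (simp add: algebra_simps)
      moreover have "norm ((x + y) + (s + t) *\<^sub>R j) - (s + t) * r \<in> S (x + y)"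
        unfolding S_def using st j add_nonneg_nonneg by blast
      ultimately show ?thesis by blast
    qed
    show "\<exists>c\<in>S (u *\<^sub>R x). c \<le> u * a" if a: "a \<in> S x" and u: "u > 0" for x a u
    proof -
      obtain s k where s: "s \<ge> 0" "k \<in> K" "a = norm (x + s *\<^sub>R k) - s * r"
        using a unfolding S_def by blast
      have "norm (u *\<^sub>R x + (u * s) *\<^sub>R k) = u * norm (x + s *\<^sub>R k)"
        using u norm_scaleR[of u "x + s *\<^sub>R k"] by (simp add: scaleR_add_right)
      then have "u * a = norm (u *\<^sub>R x + (u * s) *\<^sub>R k) - (u * s) * r"
        by (simp add: s(3) right_diff_distrib)
      moreover have "u * s \<ge> 0" using s u by simp
      ultimately have "u * a \<in> S (u *\<^sub>R x)"
        unfolding S_def using s by blast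
      then show ?thesis by blast
    qed
  qed
  have "norm x \<in> S x" for x
    unfolding S_def using k0 by (intro CollectI exI[of _ 0] exI[of _ k0]) simp
  then have le_norm: "Inf (S x) \<le> 1 * norm x" for x
    using cInf_lower[OF _ bdd] by simp
  then obtain f :: "'v dual" where f: "\<And>x. blinfun_apply f x \<le> Inf (S x)"
    using Hahn_Banach_dual[OF sub] by blast
  have "\<bar>blinfun_apply f x\<bar> \<le> norm x" for x
    using f[of x] f[of "- x"] le_norm[of x] le_norm[of "- x"] by (simp add: blinfun.minus_right)
  then have "norm f \<le> 1"
    by (intro norm_blinfun_bound) simp_all
  moreover
  have "r \<le> blinfun_apply f k" if k: "k \<in> K" for k
  proof -
    have "- r \<in> S (- k)"
      unfolding S_def using k by (intro CollectI exI[of _ 1] exI[of _ k]) simp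
    then have "Inf (S (- k)) \<le> - r"
      using cInf_lower[OF _ bdd] by blast
    then show ?thesis
      using f[of "- k"] by (simp add: blinfun.minus_right)
  qed
  ultimately show thesis by (rule that)
qed

text \<open>A closed set missing \<open>x\<close> misses a ball of radius \<open>r\<close> around
  \<open>x\<close>; after translating \<open>x\<close> to the origin, separation from the origin
  applies with that gap.\<close>

lemma closed_convex_point_functional:
  fixes K :: "'v::real_normed_vector set"
  assumes "closed K" "convex K" "K \<noteq> {}" "x \<notin> K"
  obtains f :: "'v dual" and r where "r > 0"
    "\<And>k. k \<in> K \<Longrightarrow> blinfun_apply f x + r \<le> blinfun_apply f k"
proof -
  obtain r where r: "r > 0" "ball x r \<subseteq> - K"
    using assms open_contains_ball[of "- K"] by (auto simp: open_Compl)
  have far: "r \<le> norm k" if "k \<in> (\<lambda>k. k - x) ` K" for k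
  proof -
    from that obtain l where l: "k = l - x" "l \<in> K" by (rule imageE)
    then have "l \<notin> ball x r" using r by blast
    then show ?thesis using l by (simp add: dist_norm norm_minus_commute)
  qed
  have cvx: "convex ((\<lambda>k. k - x) ` K)"
    by (simp add: assms)
  obtain f :: "'v dual" where f: "\<And>k. k \<in> (\<lambda>k. k - x) ` K \<Longrightarrow> r \<le> blinfun_apply f k"
    using convex_away_from_zero_functional[OF cvx _ far] assms by blast
  have "blinfun_apply f x + r \<le> blinfun_apply f k" if "k \<in> K" for k
    using f[of "k - x"] that by (auto simp: blinfun.diff_right)
  then show thesis using that r by blast
qed

section \<open>Weak cluster points and reflexivity\<close>

text \<open>The function \<open>f \<mapsto> limsup f (u n)\<close> is sublinear on the dual space; a linear functional
  below it is evaluation at a weak cluster point.\<close>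

lemma reflexive_weak_cluster_point:
  fixes u :: "nat \<Rightarrow> 'a::banach"
  assumes refl: "reflexive_space TYPE('a)" and u: "\<And>n. norm (u n) \<le> B"
  obtains x where "\<And>(f :: 'a dual) b. (\<forall>\<^sub>F n in sequentially. blinfun_apply f (u n) \<le> b) \<Longrightarrow> blinfun_apply f x \<le> b"
proof -
  \<comment> \<open>\<open>S f\<close> collects the eventual upper bounds of \<open>f\<close> along
    the sequence, so its infimum is the limit superior.\<close>
  define S where "S f = {b. \<forall>\<^sub>F n in sequentially. blinfun_apply f (u n) \<le> b}" for f :: "'a dual"
  have bound: "\<bar>blinfun_apply f (u n)\<bar> \<le> B * norm f" for f :: "'a dual" and n
  proof -
    have "\<bar>blinfun_apply f (u n)\<bar> \<le> norm f * norm (u n)"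
      using norm_blinfun[of f "u n"] by simp
    also have "\<dots> \<le> norm f * B"
      using u by (simp add: mult_left_mono)
    finally show ?thesis by (simp add: mult.commute)
  qed
  have in_S: "B * norm f \<in> S f" for f
    using bound[of f] by (auto simp: S_def abs_le_iff)
  have bdd: "bdd_below (S f)" for f
  proof (rule bdd_belowI)
    fix b assume "b \<in> S f"
    then obtain n where "blinfun_apply f (u n) \<le> b"
      unfolding S_def using eventually_happens'[OF sequentially_bot] by blast
    then show "- (B * norm f) \<le> b" using bound[of f n] by simp
  qed
  have sub: "sublinear (\<lambda>f. Inf (S f))"
  proof (rule sublinear_Inf[OF _ bdd])
    show "S f \<noteq> {}" for f using in_S by blast
    show "\<exists>c\<in>S (f + g). c \<le> a + b" if ab: "a \<in> S f" "b \<in> S g" for f g a b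
    proof -
      have "\<forall>\<^sub>F n in sequentially. blinfun_apply f (u n) \<le> a"
        "\<forall>\<^sub>F n in sequentially. blinfun_apply g (u n) \<le> b"
        using ab by (auto simp: S_def)
      then have "a + b \<in> S (f + g)"
        unfolding S_def mem_Collect_eq by eventually_elim (simp add: blinfun.add_left)
      then show ?thesis by blast
    qed
    show "\<exists>c\<in>S (t *\<^sub>R f). c \<le> t * a" if "a \<in> S f" "t > 0" for f a t
      using that by (intro bexI[of _ "t * a"]) (auto simp: S_def blinfun.scaleR_left)
  qed
  have "Inf (S f) \<le> B * norm f" for f
    using cInf_lower[OF in_S bdd] .
  \<comment> \<open>The bound \<open>B * norm f\<close> makes the functional continuous on the dual
    space, so it lies in the bidual, where reflexivity represents it by a point.\<close>
  then obtain F :: "'a dual dual" where F: "\<And>f. blinfun_apply F f \<le> Inf (S f)"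
    using Hahn_Banach_dual[OF sub] by blast
  obtain x where x: "F = canonical_embedding x"
    using refl unfolding reflexive_space_def by (metis surjD)
  have "blinfun_apply f x \<le> b" if "\<forall>\<^sub>F n in sequentially. blinfun_apply f (u n) \<le> b"
    for f :: "'a dual" and b
  proof -
    have "Inf (S f) \<le> b"
      using that by (intro cInf_lower bdd) (simp add: S_def)
    then show ?thesis using F[of f] x by simp
  qed
  then show thesis by (rule that)
qed

text \<open>Mazur's theorem: a closed convex set is weakly closed because a functional separates it
  from any outside point. The members \<open>y n\<close> follow \<open>z + u n\<close> up to a
  norm-null error, which covers shifts by \<open>z\<close> and sequences in a nearby set.\<close>

lemma closed_convex_contains_weak_cluster_point:
  fixes u y :: "nat \<Rightarrow> 'v::real_normed_vector"
  assumes K: "closed K" "convex K"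
    and x: "\<And>(f :: 'v dual) b. (\<forall>\<^sub>F n in sequentially. blinfun_apply f (u n) \<le> b) \<Longrightarrow> blinfun_apply f x \<le> b"
    and y: "\<forall>\<^sub>F n in sequentially. y n \<in> K"
    and lim: "(\<lambda>n. y n - (z + u n)) \<longlonglongrightarrow> 0"
  shows "z + x \<in> K"
proof (rule ccontr)
  assume "z + x \<notin> K"
  moreover have "K \<noteq> {}"
    using eventually_happens'[OF sequentially_bot y] by blast
  ultimately obtain f :: "'v dual" and r where f: "r > 0"
    "\<And>k. k \<in> K \<Longrightarrow> blinfun_apply f (z + x) + r \<le> blinfun_apply f k"
    using closed_convex_point_functional[OF K, of "z + x"] by blast
  have "(\<lambda>n. blinfun_apply f (y n - (z + u n))) \<longlonglongrightarrow> blinfun_apply f 0"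
    by (rule blinfun.tendsto[OF tendsto_const lim])
  then have "\<forall>\<^sub>F n in sequentially. blinfun_apply f (y n - (z + u n)) < r / 2"
    using f(1) by (intro order_tendstoD(2)[of _ "blinfun_apply f 0"]) simp_all
  \<comment> \<open>\<open>x\<close> is known through upper bounds, so the lower bound
    \<open>f x + r / 2\<close> for \<open>f (u n)\<close> is fed in through \<open>- f\<close>; the
    other half of \<open>r\<close> absorbs the error.\<close>
  with y have "\<forall>\<^sub>F n in sequentially. blinfun_apply (- f) (u n) \<le> - blinfun_apply f x - r / 2"
  proof eventually_elim
    case (elim n)
    then show ?case
      using f(2)[of "y n"] 
      by (simp add: blinfun.diff_right blinfun.add_right blinfun.minus_left)
  qed
  from x[OF this] show False
    using f(1) by (simp add: blinfun.minus_left)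
qed

section \<open>Barrier cones and coercivity\<close>

text \<open>Baire category: the dual ball around an interior point of the barrier cone is the union
  of the closed sets on which the support function is at most \<open>m\<close>, \<open>m \<in> \<nat>\<close>.\<close>

lemma interior_barrier_cone_coercive:
  fixes C :: "'v::real_normed_vector set"
  assumes "interior (barrier_cone C) \<noteq> {}"
  obtains f :: "'v dual" and s m where "s > 0"
    "\<And>c. c \<in> C \<Longrightarrow> blinfun_apply f c + s * norm c \<le> m"
proof -
  define A where "A m = {f :: 'v dual. \<forall>c\<in>C. blinfun_apply f c \<le> real m}" for m :: nat
  have closed: "closed (A m)" for m
  proof -
    have "A m = (\<Inter>c\<in>C. {f. blinfun_apply f c \<le> real m})"
      by (auto simp: A_def)
    then show ?thesis
      by (auto intro!: closed_INT closed_Collect_le continuous_intros)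
  qed
  have cover: "barrier_cone C \<subseteq> \<Union> (range A)"
  proof
    fix f assume f: "f \<in> barrier_cone C"
    then obtain m :: nat where "(SUP c\<in>C. ereal (blinfun_apply f c)) < ereal (real m)"
      unfolding barrier_cone_def using less_PInf_Ex_of_nat by auto
    then have "blinfun_apply f c \<le> real m" if "c \<in> C" for c
      using that by (auto simp: less_SUP_iff dest!: SUP_lessD)
    then show "f \<in> \<Union> (range A)"
      by (auto simp: A_def)
  qed
  have "\<exists>m. interior (A m) \<noteq> {}"
  proof (rule ccontr)
    assume "\<nexists>m. interior (A m) \<noteq> {}"
    \<comment> \<open>The dual space is complete, so countably many closed sets with empty interior
      have a union with empty interior.\<close>
    then have "euclidean interior_of \<Union> (range A) = {}"
      using closed
      by (intro Baire_category_alt disjI1 completely_metrizable_space_euclidean) auto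
    then show False
      using interior_mono[OF cover] assms by auto
  qed
  then obtain m f where "f \<in> interior (A m)" by blast
  then obtain e where e: "e > 0" "ball f e \<subseteq> A m"
    by (auto simp: mem_interior)
  have "blinfun_apply f c + e / 2 * norm c \<le> real m" if c: "c \<in> C" for c
  proof -
    \<comment> \<open>A norming functional, from separating the singleton \<open>{c}\<close> from
      the origin; moving \<open>f\<close> by \<open>(e / 2) *\<^sub>R g\<close> stays inside the
      open ball and gains at least \<open>e / 2 * norm c\<close> at \<open>c\<close>.\<close>
    obtain g :: "'v dual" where g: "norm g \<le> 1" "norm c \<le> blinfun_apply g c"
      using convex_away_from_zero_functional[of "{c}" "norm c"] by auto
    have "dist f (f + (e / 2) *\<^sub>R g) < e"
      using g e by (simp add: dist_norm)
    then have "f + (e / 2) *\<^sub>R g \<in> A m"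
      using e by auto
    then have "blinfun_apply f c + e / 2 * blinfun_apply g c \<le> real m"
      using c by (auto simp: A_def blinfun.add_left blinfun.scaleR_left)
    moreover have "e / 2 * norm c \<le> e / 2 * blinfun_apply g c"
      using g e by (intro mult_left_mono) simp_all
    ultimately show ?thesis by simp
  qed
  then show thesis using that[of "e / 2" f "real m"] e by simp
qed

section \<open>Positive distance between the two sets\<close>

lemma disjoint_closed_convex_positive_distance:
  fixes C D :: "'a::banach set"
  assumes refl: "reflexive_space TYPE('a)"
    and C: "closed C" "convex C" and D: "closed D" "convex D"
    and disj: "C \<inter> D = {}" and rec: "recession_cone C \<inter> recession_cone D = {0}"
    and int: "interior (barrier_cone C) \<noteq> {}"
  obtains r where "r > 0" "\<And>c d. c \<in> C \<Longrightarrow> d \<in> D \<Longrightarrow> r \<le> norm (d - c)"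
proof (rule ccontr)
  assume "\<not> thesis"
  then have close: "\<exists>c\<in>C. \<exists>d\<in>D. norm (d - c) < r" if "r > 0" for r
    using that \<open>\<And>r. \<lbrakk>0 < r; \<And>c d. \<lbrakk>c \<in> C; d \<in> D\<rbrakk> \<Longrightarrow> r \<le> norm (d - c)\<rbrakk> \<Longrightarrow> thesis\<close>
    by (meson not_less)
  have to_zero: "w \<longlonglongrightarrow> 0" if "\<And>n. norm (w n) < inverse (real (Suc n))" for w :: "nat \<Rightarrow> 'a"
    using LIMSEQ_inverse_real_of_nat that
    by (intro Lim_null_comparison[of w "\<lambda>n. inverse (real (Suc n))"]) (auto intro!: always_eventually less_imp_le)
  show False
  proof (cases "\<exists>B. \<forall>r>0. \<exists>c\<in>C. \<exists>d\<in>D. norm (d - c) < r \<and> norm c \<le> B")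
    case True
    then obtain B where B: "\<And>r. r > 0 \<Longrightarrow> \<exists>c\<in>C. \<exists>d\<in>D. norm (d - c) < r \<and> norm c \<le> B"
      by blast
    have "\<exists>c d. c \<in> C \<and> d \<in> D \<and> norm (d - c) < inverse (real (Suc n)) \<and> norm c \<le> B" for n
      using B[of "inverse (real (Suc n))"] by auto
    then obtain c d where cd: "\<And>n. c n \<in> C" "\<And>n. d n \<in> D"
      "\<And>n. norm (d n - c n) < inverse (real (Suc n))" "\<And>n. norm (c n) \<le> B"
      by metis
    obtain x where x: "\<And>(f :: 'a dual) b. (\<forall>\<^sub>F n in sequentially. blinfun_apply f (c n) \<le> b)
        \<Longrightarrow> blinfun_apply f x \<le> b"
      by (rule reflexive_weak_cluster_point[where u = c, OF refl cd(4)]) blast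
    have "0 + x \<in> C"
      using cd by (intro closed_convex_contains_weak_cluster_point[where u = c and y = c, OF C x]) simp_all
    moreover have "0 + x \<in> D"
      using cd to_zero[OF cd(3)]
      by (intro closed_convex_contains_weak_cluster_point[where u = c and y = d, OF D x]) simp_all
    ultimately show False using disj by auto
  next
    case False
    have "\<exists>c d. c \<in> C \<and> d \<in> D \<and> norm (d - c) < inverse (real (Suc n)) \<and> real (Suc n) < norm c" for n
    proof -
      \<comment> \<open>For the bound \<open>real (Suc n)\<close> there is a threshold
        \<open>r\<close> such that in every closer pair the point of \<open>C\<close> exceeds the
        bound; the minimum with \<open>inverse (real (Suc n))\<close> also sends the distances to
        zero.\<close>
      obtain r where r: "r > 0" "\<And>c d. c \<in> C \<Longrightarrow> d \<in> D \<Longrightarrow> norm (d - c) < r \<Longrightarrow> real (Suc n) < norm c"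
        using False by (meson not_le)
      then show ?thesis
        using close[of "min r (inverse (real (Suc n)))"] by auto
    qed
    then obtain c d where cd: "\<And>n. c n \<in> C" "\<And>n. d n \<in> D"
      "\<And>n. norm (d n - c n) < inverse (real (Suc n))" "\<And>n. real (Suc n) < norm (c n)"
      by metis
    define e where "e n = inverse (norm (c n))" for n
    have e_pos: "e n > 0" and e_less: "e n < inverse (real (Suc n))" for n
      using cd(4)[of n] by (auto simp: e_def intro!: less_imp_inverse_less order_le_less_trans[OF _ cd(4)])
    have e_le: "e n \<le> 1" for n
      using e_less[of n] le_imp_inverse_le[of 1 "real (Suc n)"] by simp
    have e_lim: "e \<longlonglongrightarrow> 0"
      using LIMSEQ_inverse_real_of_nat
      by (rule Lim_null_comparison[rotated])
        (use e_pos e_less in \<open>auto intro!: always_eventually simp: less_imp_le abs_of_pos\<close>)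
    define u where "u n = e n *\<^sub>R c n" for n
    have norm_u: "norm (u n) \<le> 1" for n
      using e_pos[of n] by (simp add: u_def e_def)
    obtain v where v: "\<And>(f :: 'a dual) b. (\<forall>\<^sub>F n in sequentially. blinfun_apply f (u n) \<le> b)
        \<Longrightarrow> blinfun_apply f v \<le> b"
      by (rule reflexive_weak_cluster_point[where u = u, OF refl norm_u]) blast
    have rec_v: "v \<in> recession_cone K"
      if K: "closed K" "convex K" and w: "\<And>n. w n \<in> K" "(\<lambda>n. w n - c n) \<longlonglongrightarrow> 0" for K w
    proof -
      \<comment> \<open>The weight \<open>e n\<close> tends to zero while
        \<open>e n *\<^sub>R w n\<close> follows \<open>u n\<close>, so convex combinations of
        \<open>z\<close> and \<open>w n\<close> approach \<open>z + u n\<close>.\<close>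
      have "z + v \<in> K" if z: "z \<in> K" for z
      proof (rule closed_convex_contains_weak_cluster_point[where u = u, OF K v])
        show "\<forall>\<^sub>F n in sequentially. (1 - e n) *\<^sub>R z + e n *\<^sub>R w n \<in> K"
          using z w e_le e_pos by (intro always_eventually allI convexD[OF K(2)]) (auto simp: less_imp_le)
        have "(\<lambda>n. e n *\<^sub>R (w n - c n) - e n *\<^sub>R z) \<longlonglongrightarrow> 0 *\<^sub>R 0 - 0 *\<^sub>R z"
          by (intro tendsto_intros e_lim w)
        then show "(\<lambda>n. (1 - e n) *\<^sub>R z + e n *\<^sub>R w n - (z + u n)) \<longlonglongrightarrow> 0"
          by (simp add: u_def algebra_simps)
      qed
      then show ?thesis by (simp add: recession_cone_def)
    qed
    have "v \<in> recession_cone C"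
      using cd by (intro rec_v[OF C, of c]) simp_all
    moreover have "v \<in> recession_cone D"
      using cd to_zero[OF cd(3)] by (intro rec_v[OF D, of d]) simp_all
    ultimately have "v = 0" using rec by blast
    \<comment> \<open>Coercivity divided by \<open>norm (c n)\<close> turns
      \<open>s * norm (c n)\<close> into \<open>s\<close> while the share of \<open>m\<close> tends
      to zero, so \<open>f v \<le> - s / 2\<close>, impossible for \<open>v = 0\<close>.\<close>
    obtain f s m where f: "s > 0" "\<And>c. c \<in> C \<Longrightarrow> blinfun_apply f c + s * norm c \<le> m"
      using interior_barrier_cone_coercive[OF int] by blast
    have "(\<lambda>n. e n * m) \<longlonglongrightarrow> 0 * m"
      by (intro tendsto_intros e_lim)
    then have "\<forall>\<^sub>F n in sequentially. e n * m < s / 2"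
      using f(1) by (intro order_tendstoD(2)[of _ "0 * m"]) simp_all
    then have "\<forall>\<^sub>F n in sequentially. blinfun_apply f (u n) \<le> - s / 2"
    proof eventually_elim
      case (elim n)
      have "e n * (blinfun_apply f (c n) + s * norm (c n)) \<le> e n * m"
        using f(2)[OF cd(1)] e_pos[of n] by (intro mult_left_mono) simp_all
      moreover have "e n * norm (c n) = 1"
        using e_pos[of n] by (simp add: e_def)
      ultimately have "blinfun_apply f (u n) + s \<le> e n * m"
        by (simp add: u_def blinfun.scaleR_right distrib_left mult.left_commute)
      then show ?case using elim by simp
    qed
    from v[OF this] show False
      using f(1) \<open>v = 0\<close> by simp
  qed
qed

section \<open>Strong separation from positive distance\<close>

theorem theorem8:
  fixes C D :: "'a::banach set"
  assumes "reflexive_space TYPE('a)"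
    and "closed C" and "convex C" and "C \<noteq> {}"
    and "closed D" and "convex D" and "D \<noteq> {}"
    and "C \<inter> D = {}"
    and "recession_cone C \<inter> recession_cone D = {0}"
    and "interior (barrier_cone C) \<union> interior (barrier_cone D) \<noteq> {}"
  shows "strongly_separated C D"
proof -
  \<comment> \<open>Distance is symmetric in the two sets, so an interior point of either barrier
    cone suffices.\<close>
  have "\<exists>r>0. \<forall>c\<in>C. \<forall>d\<in>D. r \<le> norm (d - c)"
  proof (cases "interior (barrier_cone C) = {}")
    case False
    then show ?thesis
      using disjoint_closed_convex_positive_distance[of C D] assms by metis
  next
    case True
    then have "interior (barrier_cone D) \<noteq> {}" using assms by simp
    then show ?thesis
      using disjoint_closed_convex_positive_distance[of D C] assms
      by (metis Int_commute norm_minus_commute)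
  qed
  then obtain r where r: "r > 0" "\<And>c d. c \<in> C \<Longrightarrow> d \<in> D \<Longrightarrow> r \<le> norm (d - c)"
    by blast
  \<comment> \<open>A positive distance between the sets means that their convex difference set
    avoids a ball around the origin.\<close>
  define K where "K = (\<Union>d\<in>D. \<Union>c\<in>C. {d - c})"
  have K: "convex K" "K \<noteq> {}"
    unfolding K_def using assms by (auto intro!: convex_differences)
  have "r \<le> norm k" if "k \<in> K" for k
    using that r(2) by (auto simp: K_def)
  then obtain f :: "'a dual" where f: "\<And>k. k \<in> K \<Longrightarrow> r \<le> blinfun_apply f k"
    using convex_away_from_zero_functional[OF K] by blast
  have sep: "blinfun_apply f c + r \<le> blinfun_apply f d" if "c \<in> C" "d \<in> D" for c d
    using f[of "d - c"] that by (force simp: K_def blinfun.diff_right)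
  obtain c0 d0 where c0: "c0 \<in> C" and d0: "d0 \<in> D" using assms by blast
  \<comment> \<open>A real supremum, finite because \<open>f d0\<close> bounds \<open>f\<close> on
    \<open>C\<close>; the reals \<open>a\<close> and \<open>a + r\<close> lie between the
    extended-real supremum and infimum.\<close>
  define a where "a = Sup (blinfun_apply f ` C)"
  have le_a: "blinfun_apply f c \<le> a" if "c \<in> C" for c
    unfolding a_def using that sep[OF _ d0]
    by (intro cSup_upper bdd_aboveI[of _ "blinfun_apply f d0"]) (use r(1) in force)+
  have a_le: "a + r \<le> blinfun_apply f d" if "d \<in> D" for d
  proof -
    have "a \<le> blinfun_apply f d - r"
      unfolding a_def using c0 sep[OF _ that] by (intro cSup_least) (auto simp: le_diff_eq)
    then show ?thesis by simp
  qed
  have "(SUP c\<in>C. ereal (blinfun_apply f c)) \<le> ereal a"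
    by (rule SUP_least) (simp add: le_a)
  also have "ereal a < ereal (a + r)" using r by simp
  also have "\<dots> \<le> (INF d\<in>D. ereal (blinfun_apply f d))"
    by (rule INF_greatest) (simp add: a_le)
  finally have "(SUP c\<in>C. ereal (blinfun_apply f c)) < (INF d\<in>D. ereal (blinfun_apply f d))" .
  moreover have "f \<noteq> 0"
    using sep[OF c0 d0] r by auto
  ultimately show ?thesis
    unfolding strongly_separated_def by blast
qed

end
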